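(* Let $\ell$ and $h$ be integers with $1\le h\le \ell$. The minimum distance of the binary linear code $K(\ell,h,1)$ is $$\sum_{a=1}^{h}\binom{\ell-1}{a-1}.$$
   Context: For integers $0\le h\le \ell$ and $j\ge 0$, let $P\subseteq \mathbb{F}_2^\ell$ be the set of all vectors having at most $h$ nonzero entries (this is the union of the coordinate subspaces $X_\sigma=\mathrm{span}\{e_i : i\in\sigma\}$ over all $\sigma\subseteq\{1,\dots,\ell\}$ with $|\sigma|\le h$, i.e. over all faces of the simplicial complex $\Delta(\ell,h)$, the "$h$-skeleton" on $\ell$ vertices). Write $P=\{p_1,\dots,p_n\}$. The $h$-skeleton code $K(\ell,h,j)\subseteq \mathbb{F}_2^n$ is the image of the linear map $f\mapsto (f(p_1),\dots,f(p_n))$ defined on the space of all polynomials of total degree at most $j$ in $\mathbb{F}_2[x_1,\dots,x_\ell]$. The minimum distance of a linear code is the minimum Hamming weight (number of nonzero coordinates) of a nonzero codeword. *)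

theory Defs
  imports
    "HOL-Library.Z2"
    "HOL-Library.Poly_Mapping"
    "Jordan_Normal_Form.Matrix"
begin

text \<open>The field with two elements is the type \<^typ>\<open>bit\<close>, and its \<open>l\<close>-dimensional coordinate
  space is \<^term>\<open>carrier_vec l :: bit vec set\<close>. Coordinates and variables are numbered from
  \<open>0\<close> to \<open>l - 1\<close>.\<close>

definition hamming_weight :: "'a::zero vec \<Rightarrow> nat" where
  "hamming_weight v = card {i. i < dim_vec v \<and> v $ i \<noteq> 0}"

definition skeleton_points :: "nat \<Rightarrow> nat \<Rightarrow> bit vec set" where
  "skeleton_points l h = {v \<in> carrier_vec l. hamming_weight v \<le> h}"

text \<open>A polynomial is a finitely supported map from monomials to coefficients, and a monomial is a
  finitely supported map from variables to exponents. Polynomials are formal objects: exponents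
  are not reduced modulo \<open>x\<^sup>2 = x\<close>.\<close>

type_synonym monomial = "nat \<Rightarrow>\<^sub>0 nat"
type_synonym 'a mpolynomial = "monomial \<Rightarrow>\<^sub>0 'a"

definition monomial_degree :: "monomial \<Rightarrow> nat" where
  "monomial_degree m = (\<Sum>i\<in>Poly_Mapping.keys m. Poly_Mapping.lookup m i)"

definition polys_degree_le :: "nat \<Rightarrow> nat \<Rightarrow> 'a::zero mpolynomial set" where
  "polys_degree_le l j = {f. \<forall>m\<in>Poly_Mapping.keys f. Poly_Mapping.keys m \<subseteq> {..<l} \<and> monomial_degree m \<le> j}"

definition eval_poly_at :: "'a::comm_semiring_1 mpolynomial \<Rightarrow> 'a vec \<Rightarrow> 'a" where
  "eval_poly_at f v = (\<Sum>m\<in>Poly_Mapping.keys f. Poly_Mapping.lookup f m * (\<Prod>i\<in>Poly_Mapping.keys m. (v $ i) ^ Poly_Mapping.lookup m i))"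

text \<open>The code depends on the order in which the points are listed; \<open>p\<close> is meant to enumerate
  \<^term>\<open>skeleton_points l h\<close> bijectively by \<open>0, \<dots>, n - 1\<close>.\<close>

definition skeleton_code :: "(nat \<Rightarrow> bit vec) \<Rightarrow> nat \<Rightarrow> nat \<Rightarrow> nat \<Rightarrow> bit vec set" where
  "skeleton_code p l h j =
     (\<lambda>f. vec (card (skeleton_points l h)) (\<lambda>i. eval_poly_at f (p i))) ` polys_degree_le l j"

text \<open>Meaningful only for a code that has a nonzero codeword.\<close>

definition minimum_distance :: "'a::zero vec set \<Rightarrow> nat" where
  "minimum_distance C = (LEAST w. \<exists>c\<in>C. c \<noteq> 0\<^sub>v (dim_vec c) \<and> hamming_weight c = w)"

end

theory Submission
  imports Defs
begin

text \<open>
  A polynomial of degree at most one is affine. If its coefficient at \<open>x\<^sub>i\<close> is nonzero, then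
  for every \<open>A \<subseteq> {..<l} - {i}\<close> it takes the value one at exactly one of the indicator vectors of
  \<open>A\<close> and \<open>insert i A\<close>; a nonzero constant is one at both. Each \<open>A\<close> with at most \<open>h - 1\<close> elements thus
  contributes at least one to the weight, and for \<open>x\<^sub>0\<close> nothing else contributes.
\<close>

text \<open>A positive exponent at \<open>i\<close> already uses up the whole degree, so all other
  exponents vanish. The second case keeps the fact that \<open>i\<close> occurs in \<open>m\<close>,
  because a bound on the variables of \<open>m\<close> then yields \<open>i < l\<close>.\<close>

lemma monomial_degree_le_1_cases:
  assumes "monomial_degree m \<le> 1"
  obtains "m = 0" | i where "i \<in> Poly_Mapping.keys m" and "m = Poly_Mapping.single i 1"
proof (cases "m = 0")
  case False
  then obtain i where i: "i \<in> Poly_Mapping.keys m"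
    by fastforce
  have "monomial_degree m =
      Poly_Mapping.lookup m i + (\<Sum>k\<in>Poly_Mapping.keys m - {i}. Poly_Mapping.lookup m k)"
    unfolding monomial_degree_def by (rule sum.remove) (use i in auto)
  moreover have "Poly_Mapping.lookup m i > 0"
    using i by (simp add: in_keys_iff)
  ultimately have one: "Poly_Mapping.lookup m i = 1"
    and rest: "(\<Sum>k\<in>Poly_Mapping.keys m - {i}. Poly_Mapping.lookup m k) = 0"
    using assms by linarith+
  have "Poly_Mapping.lookup m k = 0" if "k \<noteq> i" for k
    using rest that by (simp add: in_keys_iff) blast
  then have "m = Poly_Mapping.single i 1"
    using one by (intro poly_mapping_eqI) (auto simp: lookup_single when_def)
  then show ?thesis
    using i that(2) by blast
qed (use that in blast)

text \<open>The support of \<open>f\<close> lies among the monomials 1 and \<open>x_i\<close> with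
  \<open>i < l\<close>. Monomials outside the support have coefficient zero, so the sum may be
  enlarged to all of these and then reindexed by variables.\<close>

lemma eval_poly_at_degree_le_1:
  fixes f :: "'a::comm_semiring_1 mpolynomial"
  assumes "f \<in> polys_degree_le l 1"
  shows "eval_poly_at f v = Poly_Mapping.lookup f 0 +
    (\<Sum>i<l. Poly_Mapping.lookup f (Poly_Mapping.single i 1) * v $ i)"
proof -
  let ?X = "\<lambda>i. Poly_Mapping.single i 1 :: monomial"
  let ?t = "\<lambda>m. Poly_Mapping.lookup f m *
    (\<Prod>i\<in>Poly_Mapping.keys m. (v $ i) ^ Poly_Mapping.lookup m i)"
  have keys_X: "Poly_Mapping.keys (?X i) = {i}" for i
    by simp
  have inj_X: "inj_on ?X {..<l}"
  proof (rule inj_onI)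
    fix i k assume "?X i = ?X k"
    then have "{i} = {k}"
      using keys_X by metis
    then show "i = k"
      by simp
  qed
  have "Poly_Mapping.keys f \<subseteq> insert 0 (?X ` {..<l})"
  proof
    fix m assume "m \<in> Poly_Mapping.keys f"
    then have "Poly_Mapping.keys m \<subseteq> {..<l}" "monomial_degree m \<le> 1"
      using assms by (auto simp: polys_degree_le_def)
    then show "m \<in> insert 0 (?X ` {..<l})"
      by (elim monomial_degree_le_1_cases) blast+
  qed
  then have "eval_poly_at f v = sum ?t (insert 0 (?X ` {..<l}))"
    unfolding eval_poly_at_def
    by (intro sum.mono_neutral_left) (auto simp: in_keys_iff)
  also have "\<dots> = ?t 0 + sum ?t (?X ` {..<l})"
  proof (rule sum.insert)
    show "0 \<notin> ?X ` {..<l}"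
      using keys_X keys_zero by (metis imageE insert_not_empty)
  qed simp
  also have "sum ?t (?X ` {..<l}) = (\<Sum>i<l. ?t (?X i))"
    by (rule sum.reindex_cong[OF inj_X refl refl])
  finally show ?thesis
    by simp
qed

text \<open>Over \<open>bit\<close> every vector is the indicator of its support, so points of the
  skeleton can be handled as sets. Elements of \<open>A\<close> from \<open>l\<close> onwards are
  ignored, hence the condition \<open>A \<subseteq> {..<l}\<close> in the facts below.\<close>

definition indicator_vec :: "nat \<Rightarrow> nat set \<Rightarrow> 'a::zero_neq_one vec" where
  "indicator_vec l A = vec l (\<lambda>i. if i \<in> A then 1 else 0)"

lemma dim_indicator_vec [simp]: "dim_vec (indicator_vec l A) = l"
  by (simp add: indicator_vec_def)

lemma indicator_vec_in_carrier [simp]: "indicator_vec l A \<in> carrier_vec l"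
  by (simp add: indicator_vec_def)

lemma index_indicator_vec [simp]:
  "i < l \<Longrightarrow> indicator_vec l A $ i = (if i \<in> A then 1 else 0)"
  by (simp add: indicator_vec_def)

lemma indicator_vec_eq_iff:
  assumes "A \<subseteq> {..<l}" and "B \<subseteq> {..<l}"
  shows "(indicator_vec l A :: 'a::zero_neq_one vec) = indicator_vec l B \<longleftrightarrow> A = B"
proof
  assume eq: "(indicator_vec l A :: 'a vec) = indicator_vec l B"
  have "i \<in> A \<longleftrightarrow> i \<in> B" if "i < l" for i
    using arg_cong[OF eq, of "\<lambda>v. v $ i"] that by (auto split: if_splits)
  then show "A = B"
    using assms by blast
qed simp

lemma hamming_weight_indicator_vec:
  assumes "A \<subseteq> {..<l}"
  shows "hamming_weight (indicator_vec l A :: 'a::zero_neq_one vec) = card A"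
proof -
  have "{i. i < l \<and> (indicator_vec l A :: 'a vec) $ i \<noteq> 0} = A"
    using assms by (auto split: if_splits)
  then show ?thesis
    by (simp add: hamming_weight_def)
qed

lemma skeleton_points_eq_image:
  "skeleton_points l h = indicator_vec l ` {A. A \<subseteq> {..<l} \<and> card A \<le> h}"
proof (intro equalityI subsetI)
  fix v assume v: "v \<in> skeleton_points l h"
  define A where "A = {i. i < l \<and> v $ i \<noteq> 0}"
  have "dim_vec v = l"
    using v by (auto simp: skeleton_points_def)
  then have "v = indicator_vec l A"
    by (intro eq_vecI) (auto simp: A_def)
  moreover have "card A \<le> h"
    using v \<open>dim_vec v = l\<close> by (simp add: skeleton_points_def hamming_weight_def A_def)
  ultimately show "v \<in> indicator_vec l ` {A. A \<subseteq> {..<l} \<and> card A \<le> h}"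
    by (auto simp: A_def)
next
  fix v :: "bit vec" assume "v \<in> indicator_vec l ` {A. A \<subseteq> {..<l} \<and> card A \<le> h}"
  then obtain A where "v = indicator_vec l A" "A \<subseteq> {..<l}" "card A \<le> h"
    by blast
  then show "v \<in> skeleton_points l h"
    using hamming_weight_indicator_vec[of A l, where 'a = bit]
    by (simp add: skeleton_points_def)
qed

text \<open>The enumeration is injective and so is passing from sets to indicator vectors, so
  indices, points and sets are equinumerous. From here on weights are cardinalities of set families,
  independent of \<open>p\<close>.\<close>

lemma hamming_weight_codeword:
  fixes f :: "bit mpolynomial"
  assumes "bij_betw p {..<card (skeleton_points l h)} (skeleton_points l h)"
  shows "hamming_weight (vec (card (skeleton_points l h)) (\<lambda>k. eval_poly_at f (p k))) =
    card {A. A \<subseteq> {..<l} \<and> card A \<le> h \<and> eval_poly_at f (indicator_vec l A) \<noteq> 0}"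
    (is "_ = card ?S")
proof -
  let ?n = "card (skeleton_points l h)"
  let ?K = "{k. k < ?n \<and> eval_poly_at f (p k) \<noteq> 0}"
  have "hamming_weight (vec ?n (\<lambda>k. eval_poly_at f (p k))) = card ?K"
    by (auto simp: hamming_weight_def intro!: arg_cong[where f = card])
  also have "\<dots> = card (p ` ?K)"
    by (rule card_image[symmetric], rule inj_on_subset[of _ "{..<?n}"])
      (use assms in \<open>auto simp: bij_betw_def\<close>)
  also have "p ` ?K = {v \<in> skeleton_points l h. eval_poly_at f v \<noteq> 0}"
    using bij_betw_imp_surj_on[OF assms] by force
  also have "\<dots> = indicator_vec l ` ?S"
    by (auto simp: skeleton_points_eq_image)
  also have "card \<dots> = card ?S"
    by (rule card_image) (auto intro!: inj_onI simp: indicator_vec_eq_iff)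
  finally show ?thesis .
qed

lemma card_subsets_card_le:
  assumes "finite B"
  shows "card {A. A \<subseteq> B \<and> card A \<le> k} = (\<Sum>a\<le>k. card B choose a)"
proof -
  have "{A. A \<subseteq> B \<and> card A \<le> k} = (\<Union>a\<le>k. {A. A \<subseteq> B \<and> card A = a})"
    by auto
  also have "card \<dots> = (\<Sum>a\<le>k. card {A. A \<subseteq> B \<and> card A = a})"
    by (rule card_UN_disjoint) (use assms in auto)
  finally show ?thesis
    by (simp add: n_subsets[OF assms])
qed

lemma card_small_subsets_avoiding:
  assumes "1 \<le> h" and "i < l"
  shows "card {A. A \<subseteq> {..<l} - {i} \<and> card A \<le> h - 1} = (\<Sum>a = 1..h. (l - 1) choose (a - 1))"
proof -
  have "card {A. A \<subseteq> {..<l} - {i} \<and> card A \<le> h - 1} = (\<Sum>a\<le>h - 1. (l - 1) choose a)"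
    using assms(2) by (simp add: card_subsets_card_le)
  \<comment> \<open>The shift from \<open>a\<close> to \<open>Suc a\<close> maps
    \<open>0..h - 1\<close> onto \<open>1..h\<close>; since subtraction is truncated, this relies on
    \<open>1 \<le> h\<close>.\<close>
  also have "\<dots> = (\<Sum>a = 1..h. (l - 1) choose (a - 1))"
    by (rule sum.reindex_bij_witness[of _ "\<lambda>a. a - 1" Suc]) (use assms(1) in auto)
  finally show ?thesis .
qed

text \<open>Inserting \<open>i\<close> changes only coordinate \<open>i\<close>, from 0 to 1, so an
  affine function grows by its coefficient there.\<close>

lemma eval_poly_at_indicator_vec_insert:
  fixes f :: "'a::comm_semiring_1 mpolynomial"
  assumes "f \<in> polys_degree_le l 1" and "i < l" and "i \<notin> A"
  shows "eval_poly_at f (indicator_vec l (insert i A)) =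
    eval_poly_at f (indicator_vec l A) + Poly_Mapping.lookup f (Poly_Mapping.single i 1)"
proof -
  let ?a = "\<lambda>k. Poly_Mapping.lookup f (Poly_Mapping.single k 1)"
  have "(\<Sum>k<l. ?a k * indicator_vec l (insert i A) $ k) =
      (\<Sum>k<l. ?a k * indicator_vec l A $ k + (if k = i then ?a k else 0))"
    using assms(3) by (intro sum.cong) auto
  also have "\<dots> = (\<Sum>k<l. ?a k * indicator_vec l A $ k) + ?a i"
    using assms(2) by (simp add: sum.distrib)
  finally show ?thesis
    by (simp add: eval_poly_at_degree_le_1[OF assms(1)] add.assoc)
qed

text \<open>From each pair \<open>A\<close>, \<open>insert i A\<close> one member satisfying
  \<open>P\<close> is selected, and different pairs are disjoint. Starting from at most
  \<open>h - 1\<close> elements leaves room for inserting \<open>i\<close>.\<close>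

lemma card_nonzero_ge:
  assumes "1 \<le> h" and "i < l"
    and nz: "\<And>A. A \<subseteq> {..<l} - {i} \<Longrightarrow> P A \<or> P (insert i A)"
  shows "(\<Sum>a = 1..h. (l - 1) choose (a - 1)) \<le> card {A. A \<subseteq> {..<l} \<and> card A \<le> h \<and> P A}"
proof -
  let ?D = "{A. A \<subseteq> {..<l} - {i} \<and> card A \<le> h - 1}"
  let ?S = "{A. A \<subseteq> {..<l} \<and> card A \<le> h \<and> P A}"
  let ?g = "\<lambda>A. if P A then A else insert i A"
  have "finite ?S"
    by (rule finite_subset[of _ "Pow {..<l}"]) auto
  \<comment> \<open>As \<open>i\<close> is not in \<open>A\<close>, deleting \<open>i\<close> undoes
    either choice.\<close>
  moreover have "inj_on ?g ?D"
    by (rule inj_on_inverseI[where g = "\<lambda>A. A - {i}"]) auto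
  moreover have "?g ` ?D \<subseteq> ?S"
  proof (intro image_subsetI)
    fix A assume A: "A \<in> ?D"
    have "card (insert i A) \<le> Suc (card A)"
      by (rule card_insert_le_m1) auto
    then show "?g A \<in> ?S"
      using A assms(1,2) nz[of A] by auto
  qed
  ultimately have "card ?D \<le> card ?S"
    by (meson card_inj_on_le)
  then show ?thesis
    by (simp only: card_small_subsets_avoiding[OF assms(1,2)])
qed

text \<open>Deleting \<open>i\<close> lowers the size by exactly one and gives a bijection onto the
  small subsets avoiding \<open>i\<close>. The sets counted here are those where the coordinate
  function \<open>x_i\<close> is nonzero.\<close>

lemma card_small_subsets_containing:
  assumes "1 \<le> h" and "i < l"
  shows "card {A. A \<subseteq> {..<l} \<and> card A \<le> h \<and> i \<in> A} = (\<Sum>a = 1..h. (l - 1) choose (a - 1))"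
proof -
  have "bij_betw (insert i) {A. A \<subseteq> {..<l} - {i} \<and> card A \<le> h - 1}
      {A. A \<subseteq> {..<l} \<and> card A \<le> h \<and> i \<in> A}"
  proof (rule bij_betw_byWitness[where f' = "\<lambda>A. A - {i}"])
    show "insert i ` {A. A \<subseteq> {..<l} - {i} \<and> card A \<le> h - 1} \<subseteq>
        {A. A \<subseteq> {..<l} \<and> card A \<le> h \<and> i \<in> A}"
    proof (intro image_subsetI)
      fix A assume A: "A \<in> {A. A \<subseteq> {..<l} - {i} \<and> card A \<le> h - 1}"
      then have "finite A" "i \<notin> A"
        by (auto intro: finite_subset)
      then show "insert i A \<in> {A. A \<subseteq> {..<l} \<and> card A \<le> h \<and> i \<in> A}"
        using A assms by auto
    qed
  qed (auto simp: card_Diff_singleton)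
  then show ?thesis
    by (simp only: bij_betw_same_card[symmetric] card_small_subsets_avoiding[OF assms])
qed

theorem theorem1p12:
  fixes l h :: nat and p :: "nat \<Rightarrow> bit vec"
  assumes "1 \<le> h" and "h \<le> l"
    and "bij_betw p {..<card (skeleton_points l h)} (skeleton_points l h)"
  shows "minimum_distance (skeleton_code p l h 1) = (\<Sum>a = 1..h. (l - 1) choose (a - 1))"
proof -
  let ?M = "\<Sum>a = 1..h. (l - 1) choose (a - 1)"
  let ?n = "card (skeleton_points l h)"
  let ?w = "\<lambda>f. vec ?n (\<lambda>k. eval_poly_at f (p k)) :: bit vec"
  note weight = hamming_weight_codeword[OF assms(3)]
  have "0 < l"
    using assms by simp
  have lower: "?M \<le> hamming_weight (?w f)"
    if f: "f \<in> polys_degree_le l 1" and nonzero: "?w f \<noteq> 0\<^sub>v (dim_vec (?w f))" for f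
  proof -
    \<comment> \<open>This form covers both kinds of codeword: for a nonconstant \<open>f\<close>
      the index is a variable with nonzero coefficient, for a constant \<open>f\<close> any index
      below \<open>l\<close> serves.\<close>
    have "\<exists>i<l. \<forall>A \<subseteq> {..<l} - {i}. eval_poly_at f (indicator_vec l A) \<noteq> 0 \<or>
        eval_poly_at f (indicator_vec l (insert i A)) \<noteq> 0"
    proof (cases "\<exists>i<l. Poly_Mapping.lookup f (Poly_Mapping.single i 1) \<noteq> 0")
      case True
      then obtain i where i: "i < l" "Poly_Mapping.lookup f (Poly_Mapping.single i 1) \<noteq> 0"
        by blast
      have "eval_poly_at f (indicator_vec l (insert i A)) \<noteq> 0"
        if "A \<subseteq> {..<l} - {i}" "eval_poly_at f (indicator_vec l A) = 0" for A
        using eval_poly_at_indicator_vec_insert[OF f i(1), of A] that i(2) by auto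
      then show ?thesis
        using i(1) by blast
    next
      case False
      then have const: "eval_poly_at f v = Poly_Mapping.lookup f 0" for v
        by (simp add: eval_poly_at_degree_le_1[OF f])
      then have "Poly_Mapping.lookup f 0 \<noteq> 0"
        using nonzero by (auto simp: zero_vec_def)
      then show ?thesis
        using const \<open>0 < l\<close> by auto
    qed
    then obtain i where "i < l" "\<And>A. A \<subseteq> {..<l} - {i} \<Longrightarrow>
        eval_poly_at f (indicator_vec l A) \<noteq> 0 \<or>
        eval_poly_at f (indicator_vec l (insert i A)) \<noteq> 0"
      by blast
    then show ?thesis
      unfolding weight by (intro card_nonzero_ge[OF assms(1)])
  qed
  \<comment> \<open>The coordinate function \<open>x_0\<close> attains the bound; the variable
    exists because \<open>0 < l\<close>.\<close>
  define x0 :: "bit mpolynomial" where "x0 = Poly_Mapping.single (Poly_Mapping.single 0 1) 1"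
  have x0: "x0 \<in> polys_degree_le l 1"
    using \<open>0 < l\<close> by (auto simp: x0_def polys_degree_le_def monomial_degree_def)
  have "eval_poly_at x0 v = v $ 0" for v
    by (simp add: x0_def eval_poly_at_def)
  then have "hamming_weight (?w x0) = card {A. A \<subseteq> {..<l} \<and> card A \<le> h \<and> 0 \<in> A}"
    unfolding weight using \<open>0 < l\<close> by (auto intro!: arg_cong[where f = card])
  then have attained: "hamming_weight (?w x0) = ?M"
    by (simp only: card_small_subsets_containing[OF assms(1) \<open>0 < l\<close>])
  \<comment> \<open>The minimum ranges over nonzero codewords only, so the word of \<open>x0\<close>
    must be shown to be nonzero. The summand for \<open>a = 1\<close> equals 1, which makes its
    weight positive.\<close>
  have "(l - 1) choose (1 - 1) \<le> ?M"
    by (rule member_le_sum) (use assms(1) in auto)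
  then have "1 \<le> ?M"
    by (simp only: diff_self_eq_0 binomial_n_0)
  then have "hamming_weight (?w x0) \<noteq> 0"
    unfolding attained by linarith
  then have "?w x0 \<noteq> 0\<^sub>v (dim_vec (?w x0))"
    by (auto simp: hamming_weight_def zero_vec_def vec_eq_iff)
  moreover have "?w x0 \<in> skeleton_code p l h 1"
    using x0 by (simp add: skeleton_code_def)
  ultimately show ?thesis
    unfolding minimum_distance_def
    by (intro Least_equality) (use attained lower in \<open>auto simp: skeleton_code_def\<close>)
qed

end
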